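(* Let $\frac{n-1}{n}<\gamma\le1$ and $R>0$. Then it is not true that for every positive Borel measure $\mu$ on $\mathbb{B}_n$ the conditions $$\sup_{a\in\mathbb{B}_n}\frac{\mu(D(a,R))}{(1-|a|^2)^{n\gamma}}<\infty\qquad\text{and}\qquad \sup_{\zeta\in\mathbb{S}_n,\ r\in(0,1)}\frac{\mu(Q_r(\zeta))}{r^{n\gamma}}<\infty$$ are equivalent.
   Context: $\mathbb{B}_n$ is the open unit ball of $\mathbb{C}^n$ ($n\ge1$), $\mathbb{S}_n=\partial\mathbb{B}_n$, and $\langle z,w\rangle=\sum_j z_j\overline{w_j}$. For $\zeta\in\mathbb{S}_n$ and $r\in(0,1)$ the Carleson cube is $Q_r(\zeta)=\{z\in\mathbb{B}_n:|1-\langle z,\zeta\rangle|<r\}$. For $z\in\mathbb{B}_n$, $\varphi_z$ is the involutive automorphism of $\mathbb{B}_n$ interchanging $0$ and $z$. The Bergman metric is $\beta(z,w)=\frac12\log\frac{1+|\varphi_z(w)|}{1-|\varphi_z(w)|}$, and for $R>0$ the Bergman metric ball is $D(z,R)=\{w\in\mathbb{B}_n:\beta(z,w)<R\}$. *)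

theory Defs
  imports "HOL-Analysis.Analysis"
begin

definition hinner :: "complex ^ 'n \<Rightarrow> complex ^ 'n \<Rightarrow> complex" where
  "hinner z w = (\<Sum>j\<in>UNIV. z $ j * cnj (w $ j))"

definition carleson_cube :: "complex ^ 'n \<Rightarrow> real \<Rightarrow> (complex ^ 'n) set" where
  "carleson_cube \<zeta> r = {z \<in> ball 0 1. cmod (1 - hinner z \<zeta>) < r}"

text \<open>Orthogonal projection onto the complex line spanned by \<open>a\<close>.
  For \<open>a = 0\<close> it is the zero map, since then the quotient is \<open>0\<close>.\<close>

definition cproj :: "complex ^ 'n \<Rightarrow> complex ^ 'n \<Rightarrow> complex ^ 'n" where
  "cproj a z = (hinner z a / hinner a a) *s a"

text \<open>The standard explicit form of the involutive automorphism of the unit ball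
  interchanging \<open>0\<close> and \<open>a\<close>; for \<open>a = 0\<close> it is \<open>z \<mapsto> - z\<close>.\<close>

definition ball_invol :: "complex ^ 'n \<Rightarrow> complex ^ 'n \<Rightarrow> complex ^ 'n" where
  "ball_invol a z =
     inverse (1 - hinner z a) *s
       (a - cproj a z - complex_of_real (sqrt (1 - (norm a)\<^sup>2)) *s (z - cproj a z))"

definition bergman_metric :: "complex ^ 'n \<Rightarrow> complex ^ 'n \<Rightarrow> real" where
  "bergman_metric z w =
     1 / 2 * ln ((1 + norm (ball_invol z w)) / (1 - norm (ball_invol z w)))"

definition bergman_ball :: "complex ^ 'n \<Rightarrow> real \<Rightarrow> (complex ^ 'n) set" where
  "bergman_ball z R = {w \<in> ball 0 1. bergman_metric z w < R}"

definition borel_measure_on :: "'a :: topological_space set \<Rightarrow> 'a measure \<Rightarrow> bool" where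
  "borel_measure_on S M \<longleftrightarrow> sets M = sets (restrict_space borel S)"

lemma hinner_self: "hinner a a = complex_of_real ((norm a)\<^sup>2)"
  unfolding hinner_def norm_vec_def L2_set_def
  by (simp add: sum_nonneg complex_norm_square[symmetric])

lemma hinner_add_left: "hinner (x + y) w = hinner x w + hinner y w"
  by (simp add: hinner_def sum.distrib algebra_simps)

lemma hinner_diff_left: "hinner (x - y) w = hinner x w - hinner y w"
  by (simp add: hinner_def sum_subtractf algebra_simps)

lemma hinner_scale_left: "hinner (c *s x) w = c * hinner x w"
  by (simp add: hinner_def sum_distrib_left mult.assoc)

lemma hinner_commute: "hinner w z = cnj (hinner z w)"
  by (simp add: hinner_def mult.commute)

lemma norm_hinner_le: "cmod (hinner z w) \<le> norm z * norm w"
proof -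
  have "cmod (hinner z w) \<le> (\<Sum>j\<in>UNIV. cmod (z $ j) * cmod (w $ j))"
    unfolding hinner_def by (rule order_trans[OF norm_sum]) (simp add: norm_mult)
  also have "\<dots> \<le> norm z * norm w"
    using L2_set_mult_ineq[of "\<lambda>j. cmod (z $ j)" "\<lambda>j. cmod (w $ j)" UNIV]
    by (simp add: norm_vec_def)
  finally show ?thesis .
qed

lemma hinner_neq_1:
  assumes "z \<in> ball 0 1" "a \<in> ball 0 1"
  shows "hinner z a \<noteq> 1"
proof
  assume "hinner z a = 1"
  then have "1 \<le> norm z * norm a" using norm_hinner_le[of z a] by simp
  moreover have "norm z * norm a < 1 * 1"
    using assms by (intro mult_strict_mono') auto
  ultimately show False by simp
qed

lemma ball_invol_0_left: "ball_invol 0 z = - z"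
  by (simp add: ball_invol_def cproj_def hinner_def vec_eq_iff)

lemma ball_invol_0_right: "ball_invol a 0 = a"
  by (simp add: ball_invol_def cproj_def hinner_def)

lemma ball_invol_self: "ball_invol a a = 0"
  by (cases "a = 0") (simp_all add: ball_invol_def cproj_def hinner_self vec_eq_iff)

lemma ball_invol_ball_invol:
  assumes z: "z \<in> ball 0 1" and a: "a \<in> ball 0 1"
  shows "ball_invol a (ball_invol a z) = z"
proof (cases "a = 0")
  case True
  then show ?thesis by (simp add: ball_invol_0_left)
next
  case False
  define s where "s = complex_of_real (sqrt (1 - (norm a)\<^sup>2))"
  define A where "A = hinner a a"
  define t where "t = hinner z a"
  define w where "w = ball_invol a z"
  have na: "(norm a)\<^sup>2 < 1" using a by (simp add: power_less_one_iff abs_square_less_1)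
  have s2: "s * s = 1 - A"
    using na unfolding s_def A_def hinner_self
    by (metis diff_ge_0_iff_ge less_imp_le of_real_1 of_real_diff of_real_mult real_sqrt_mult_self abs_of_nonneg)
  have A0: "A \<noteq> 0" using False by (simp add: A_def hinner_self)
  have A1: "1 - A \<noteq> 0" using na by (metis A_def hinner_self eq_iff_diff_eq_0 less_irrefl of_real_eq_1_iff)
  have t1: "1 - t \<noteq> 0" using hinner_neq_1[OF z a] by (simp add: t_def)
  have comp: "ball_invol a x $ j =
      (a$j - (hinner x a / A) * a$j - s * (x$j - (hinner x a / A) * a$j)) / (1 - hinner x a)" for x j
    unfolding ball_invol_def cproj_def A_def[symmetric] s_def[symmetric]
    by (simp only: vector_smult_component vector_minus_component divide_inverse mult.commute)
  have wa: "hinner w a = (A - t) / (1 - t)"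
  proof -
    have "hinner w a = inverse (1 - t) * (A - t / A * A - s * (t - t / A * A))"
      unfolding w_def ball_invol_def cproj_def hinner_scale_left hinner_diff_left
        A_def[symmetric] s_def[symmetric] t_def[symmetric] ..
    also have "\<dots> = (A - t) / (1 - t)"
      using A0 by (simp add: inverse_eq_divide)
    finally show ?thesis .
  qed
  have w1: "1 - hinner w a = (1 - A) / (1 - t)" using t1 by (simp add: wa diff_divide_eq_iff)
  have wt: "1 - hinner w a / A = t * (1 - A) / (A * (1 - t))"
    unfolding wa using A0 t1 by (simp add: divide_simps) (simp add: algebra_simps)
  show ?thesis
  proof (subst vec_eq_iff, rule allI)
    fix j
    define p where "p = t / A * a$j"
    have wj: "w $ j = (a$j - p - s * (z$j - p)) / (1 - t)"
      unfolding w_def comp p_def t_def ..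
    have d: "w$j - (hinner w a / A) * a$j = - s * (z$j - p) / (1 - t)"
    proof -
      have "(hinner w a / A) * a$j = (a$j - p) / (1 - t)"
        unfolding wa p_def using A0 t1 by (simp add: divide_simps) (simp add: algebra_simps)
      then show ?thesis unfolding wj by (simp add: diff_divide_distrib)
    qed
    have "a$j - (hinner w a / A) * a$j = (1 - hinner w a / A) * a$j"
      by (simp add: algebra_simps)
    also have "\<dots> = (1 - A) * p / (1 - t)"
      unfolding wt p_def using A0 t1 by (simp add: divide_simps)
    finally have e: "a$j - (hinner w a / A) * a$j = (1 - A) * p / (1 - t)" .
    have "s * (- s * (z$j - p) / (1 - t)) = - (s * s) * (z$j - p) / (1 - t)" by simp
    then have f: "(1 - A) * p / (1 - t) - s * (- s * (z$j - p) / (1 - t)) = (1 - A) * z$j / (1 - t)"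
      unfolding s2 using t1 by (simp add: divide_simps) (simp add: algebra_simps)
    have "ball_invol a w $ j = (1 - A) * z$j / (1 - t) / ((1 - A) / (1 - t))"
      unfolding comp d e f w1 ..
    then show "ball_invol a (ball_invol a z) $ j = z $ j"
      using A1 t1 by (simp add: w_def)
  qed
qed

end

theory Submission
  imports Defs
begin

text \<open>The counterexample has finite Bergman supremum but infinite mass in a single Carleson cube.
  It is the sum over \<open>k\<close> of probability measures spread evenly over a fixed patch of the sphere
  \<open>1 - (norm z)\<^sup>2 = d\<^sub>k\<close>, with \<open>d\<^sub>k = (1 / 2) ^ (k + 3)\<close> and weights \<open>d\<^sub>k powr (n * \<gamma> - n)\<close>. As \<open>\<gamma> \<le> 1\<close>
  the weights are at least \<open>1\<close>, so the total mass is infinite. A Bergman ball with centre \<open>a\<close> meets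
  boundedly many of the spheres, all with \<open>d\<^sub>k\<close> comparable to \<open>d = 1 - (norm a)\<^sup>2\<close>, and it takes up a
  fraction \<open>O(d ^ n)\<close> of each patch: its extent is \<open>O(d)\<close> in the complex direction of \<open>a\<close> and
  \<open>O(sqrt d)\<close> in the \<open>n - 1\<close> orthogonal complex directions.\<close>

section \<open>The involution identity and the shape of a Bergman ball\<close>

lemma hinner_diff_right: "hinner z (x - y) = hinner z x - hinner z y"
  by (simp add: hinner_def sum_subtractf algebra_simps)

lemma hinner_scale_right: "hinner z (c *s x) = cnj c * hinner z x"
  by (simp add: hinner_def sum_distrib_left algebra_simps)

lemma norm_vec_complex_power2:
  fixes z :: "complex ^ 'n"
  shows "(norm z)\<^sup>2 = (\<Sum>i\<in>UNIV. (cmod (z $ i))\<^sup>2)"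
  by (simp add: norm_vec_def L2_set_def sum_nonneg)

text \<open>The classical identity for the involution, cleared of its denominator. The numerator
  \<open>v\<close> of \<open>ball_invol a z\<close> splits into a multiple of \<open>a\<close> and a
  vector orthogonal to \<open>a\<close>, so \<open>hinner v v\<close> has no mixed terms.\<close>

lemma one_minus_norm_ball_invol:
  assumes a: "a \<in> ball 0 1" and z: "z \<in> ball 0 1"
  shows "(1 - (norm (ball_invol a z))\<^sup>2) * (cmod (1 - hinner z a))\<^sup>2
           = (1 - (norm a)\<^sup>2) * (1 - (norm z)\<^sup>2)"
proof (cases "a = 0")
  case True
  then show ?thesis by (simp add: ball_invol_0_left hinner_def)
next
  case False
  define s where "s = complex_of_real (sqrt (1 - (norm a)\<^sup>2))"
  define A where "A = complex_of_real ((norm a)\<^sup>2)"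
  define t where "t = hinner z a"
  define Z where "Z = complex_of_real ((norm z)\<^sup>2)"
  define v where "v = a - cproj a z - s *s (z - cproj a z)"
  have "(norm a)\<^sup>2 < 1" using a by (simp add: power_less_one_iff abs_square_less_1)
  then have s2: "s * s = 1 - A"
    unfolding s_def A_def by (simp flip: of_real_mult)
  have A0: "A \<noteq> 0" using False by (simp add: A_def)
  have cnjs: "cnj s = s" "cnj A = A" by (simp_all add: s_def A_def)
  have t1: "1 - t \<noteq> 0" using hinner_neq_1[OF z a] by (simp add: t_def)
  have h: "hinner a a = A" "hinner z z = Z" "hinner z a = t" "hinner a z = cnj t"
    by (simp_all add: hinner_self A_def Z_def t_def hinner_commute[of a z])
  have "hinner v v = (1 - t) * cnj (1 - t) - (1 - A) * (1 - Z)"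
  proof -
    \<comment> \<open>\<open>q\<close> is the squared norm of \<open>cproj a z\<close>, hence
      \<open>Z - q\<close> that of the component of \<open>z\<close> orthogonal to
      \<open>a\<close>.\<close>
    define q where "q = t * cnj t / A"
    have q: "A * q = t * cnj t" using A0 by (simp add: q_def)
    have "hinner v v = A - t - cnj t + q + s * s * (Z - q)"
      unfolding v_def cproj_def q_def
        hinner_diff_left hinner_diff_right hinner_scale_left hinner_scale_right h
      using A0 by (simp add: cnjs field_simps)
    also have "\<dots> = A - t - cnj t + Z - A * Z + A * q"
      unfolding s2 by (simp add: algebra_simps)
    finally show ?thesis unfolding q by (simp add: algebra_simps)
  qed
  then have "complex_of_real ((norm v)\<^sup>2) = complex_of_real ((cmod (1 - t))\<^sup>2 - (1 - (norm a)\<^sup>2) * (1 - (norm z)\<^sup>2))"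
    unfolding hinner_self complex_norm_square[of "1 - t", symmetric] by (simp add: A_def Z_def)
  then have nv: "(norm v)\<^sup>2 = (cmod (1 - t))\<^sup>2 - (1 - (norm a)\<^sup>2) * (1 - (norm z)\<^sup>2)"
    using of_real_eq_iff by blast
  have vb: "v = (1 - t) *s ball_invol a z"
    unfolding ball_invol_def s_def[symmetric] t_def[symmetric] v_def[symmetric]
    using t1 by (simp add: vector_smult_assoc)
  have "(norm v)\<^sup>2 = (cmod (1 - t))\<^sup>2 * (norm (ball_invol a z))\<^sup>2"
    unfolding vb
    by (simp only: norm_vec_complex_power2 vector_smult_component norm_mult power_mult_distrib sum_distrib_left)
  with nv show ?thesis by (simp add: t_def algebra_simps)
qed

text \<open>For \<open>x = norm (ball_invol a z)\<close> the metric bound reads (1 + x) / (1 - x) <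
  exp (2 * R), which keeps 1 - x^2 above exp (- 2 * R); the involution identity turns this into a
  bound on the kernel.\<close>

lemma bergman_ball_kernel_bound:
  assumes a: "a \<in> ball 0 1" and z: "z \<in> bergman_ball a R"
  shows "exp (- 2 * R) * (cmod (1 - hinner z a))\<^sup>2 \<le> (1 - (norm a)\<^sup>2) * (1 - (norm z)\<^sup>2)"
proof -
  define x where "x = norm (ball_invol a z)"
  have zb: "z \<in> ball 0 1" and m: "ln ((1 + x) / (1 - x)) < 2 * R"
    using z by (auto simp: bergman_ball_def bergman_metric_def x_def)
  have id: "(1 - x\<^sup>2) * (cmod (1 - hinner z a))\<^sup>2 = (1 - (norm a)\<^sup>2) * (1 - (norm z)\<^sup>2)"
    using one_minus_norm_ball_invol[OF a zb] by (simp add: x_def)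
  \<comment> \<open>Positivity of the right-hand side of the identity forces \<open>x < 1\<close>,
    which is needed before the logarithm can be undone.\<close>
  have "0 < (1 - (norm a)\<^sup>2) * (1 - (norm z)\<^sup>2)"
    using a zb by (simp add: abs_square_less_1)
  then have "0 < 1 - x\<^sup>2"
    unfolding id[symmetric] by (simp add: zero_less_mult_iff)
  moreover have x0: "0 \<le> x" by (simp add: x_def)
  ultimately have x1: "x < 1" by (simp add: abs_square_less_1)
  have "(1 + x) / (1 - x) < exp (2 * R)"
    using m x0 x1 by (metis exp_less_cancel_iff exp_ln divide_pos_pos add_pos_nonneg zero_less_one diff_gt_0_iff_gt)
  then have "1 + x < exp (2 * R) * (1 - x)"
    using x1 by (simp add: divide_less_eq)
  then have "1 < exp (2 * R) * (1 - x)" using x0 by linarith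
  then have "exp (- 2 * R) < 1 - x"
    by (simp add: exp_minus divide_simps mult.commute)
  also have "1 - x \<le> 1 - x\<^sup>2"
    using x0 x1 by (simp add: power2_eq_square mult_left_le)
  finally have "exp (- 2 * R) \<le> 1 - x\<^sup>2" by simp
  then show ?thesis unfolding id[symmetric] by (rule mult_right_mono) simp
qed

text \<open>Cauchy-Schwarz gives 1 - |a| as a lower bound, and 1 - |a|^2 is at most twice
  that.\<close>

lemma one_minus_hinner_ge:
  assumes "norm a < 1" "norm z < 1"
  shows "(1 - (norm a)\<^sup>2) / 2 \<le> cmod (1 - hinner z a)"
proof -
  have "norm z * norm a \<le> norm a" using assms by (simp add: mult_left_le_one_le)
  then have "1 - norm a \<le> cmod (1 - hinner z a)"
    using norm_hinner_le[of z a] norm_triangle_ineq2[of 1 "hinner z a"] by simp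
  moreover have "1 - (norm a)\<^sup>2 = (1 - norm a) * (1 + norm a)"
    by (simp add: power2_eq_square algebra_simps)
  moreover have "(1 - norm a) * (1 + norm a) \<le> (1 - norm a) * 2"
    using assms by (intro mult_left_mono) auto
  ultimately show ?thesis by simp
qed

lemma norm_diff_hinner_power2:
  "(norm (z - a))\<^sup>2 = (norm z)\<^sup>2 + (norm a)\<^sup>2 - 2 * Re (hinner z a)"
proof -
  have "complex_of_real ((norm (z - a))\<^sup>2)
      = of_real ((norm z)\<^sup>2) + of_real ((norm a)\<^sup>2) - (hinner z a + cnj (hinner z a))"
    unfolding hinner_self[symmetric] hinner_commute[of a z, symmetric] hinner_diff_left hinner_diff_right
    by simp
  also have "\<dots> = of_real ((norm z)\<^sup>2 + (norm a)\<^sup>2 - 2 * Re (hinner z a))"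
    by (simp add: complex_add_cnj)
  finally show ?thesis using of_real_eq_iff by blast
qed

text \<open>Everything used later about a Bergman ball: the first two bounds select the spheres it
  meets, the last two locate it within a sphere. With \<open>h\<close> the modulus of the kernel and
  \<open>dz\<close> equal to 1 - |z|^2, the bound 2 h^2 \<le> B d dz is played off against d / 2
  \<le> h and dz / 2 \<le> h. The factor 2 in \<open>B\<close> absorbs these halves.\<close>

lemma bergman_ball_bounds:
  assumes a: "a \<in> ball 0 1" and z: "z \<in> bergman_ball a R" and R: "R > 0"
  defines "B \<equiv> 2 * exp (2 * R)" and "d \<equiv> 1 - (norm a)\<^sup>2"
  shows "d \<le> 2 * B * (1 - (norm z)\<^sup>2)" and "1 - (norm z)\<^sup>2 \<le> 2 * B * d"
    and "cmod (1 - hinner z a) \<le> B * d" and "(norm (z - a))\<^sup>2 \<le> 2 * B * d"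
proof -
  have zb: "norm z < 1" and ab: "norm a < 1" using z a by (auto simp: bergman_ball_def)
  define h where "h = cmod (1 - hinner z a)"
  define dz where "dz = 1 - (norm z)\<^sup>2"
  have "exp (- 2 * R) * h\<^sup>2 \<le> d * dz"
    using bergman_ball_kernel_bound[OF a z] by (simp add: h_def d_def dz_def)
  then have "exp (2 * R) * (exp (- 2 * R) * h\<^sup>2) \<le> exp (2 * R) * (d * dz)" by simp
  then have "exp (2 * R) * exp (- 2 * R) * h\<^sup>2 \<le> exp (2 * R) * (d * dz)"
    by (simp only: mult.assoc)
  then have k: "2 * h\<^sup>2 \<le> B * (d * dz)"
    by (simp add: B_def exp_minus)
  have d0: "0 < d" "0 < dz" using ab zb by (simp_all add: d_def dz_def abs_square_less_1)
  have h0: "0 \<le> h" by (simp add: h_def)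
  have hd: "d / 2 \<le> h" using one_minus_hinner_ge[OF ab zb] by (simp add: h_def d_def)
  have "cmod (1 - hinner a z) = h"
    unfolding h_def hinner_commute[of a z] by (metis complex_cnj_diff complex_cnj_one complex_mod_cnj)
  then have hdz: "dz / 2 \<le> h" using one_minus_hinner_ge[OF zb ab] by (simp add: dz_def)
  have "d * d \<le> 2 * (2 * h\<^sup>2)"
    using mult_mono[OF hd hd h0] d0 by (simp add: power2_eq_square)
  also have "\<dots> \<le> 2 * (B * (d * dz))" using k by simp
  finally have "d * d \<le> 2 * B * dz * d" by (simp add: mult_ac)
  then show 1: "d \<le> 2 * B * (1 - (norm z)\<^sup>2)"
    using d0 by (simp add: dz_def)
  have "dz * dz \<le> 2 * (2 * h\<^sup>2)"
    using mult_mono[OF hdz hdz h0] d0 by (simp add: power2_eq_square)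
  also have "\<dots> \<le> 2 * (B * (d * dz))" using k by simp
  finally have "dz * dz \<le> 2 * B * d * dz" by (simp add: mult_ac)
  then show "1 - (norm z)\<^sup>2 \<le> 2 * B * d"
    using d0 by (simp add: dz_def)
  have B: "0 < B" by (simp add: B_def)
  have "B * (d * dz) \<le> B * (d * (2 * h))"
    using hdz d0 B by (intro mult_left_mono) auto
  then have "h * h \<le> B * d * h" using k by (simp add: power2_eq_square)
  moreover have "0 < h" using hd d0 by simp
  ultimately show 3: "cmod (1 - hinner z a) \<le> B * d" by (simp add: h_def)
  \<comment> \<open>The exact value of the left-hand side is 2 Re (1 - <z,a>) - d - dz.\<close>
  have "(norm (z - a))\<^sup>2 \<le> 2 * Re (1 - hinner z a)"
    using d0 by (simp add: norm_diff_hinner_power2 d_def dz_def)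
  also have "\<dots> \<le> 2 * (B * d)"
    using complex_Re_le_cmod[of "1 - hinner z a"] 3 by linarith
  finally show "(norm (z - a))\<^sup>2 \<le> 2 * B * d" by simp
qed

section \<open>Lebesgue measure on the parameter cube\<close>

definition unit_square :: "complex measure" where
  "unit_square = restrict_space lborel (cbox 0 (Complex 1 1))"

lemma cbox_complex: "cbox a b = {z. Re a \<le> Re z \<and> Re z \<le> Re b \<and> Im a \<le> Im z \<and> Im z \<le> Im b}"
  by (auto simp: cbox_def Basis_complex_def)

lemma emeasure_lborel_cbox_complex:
  assumes "Re a \<le> Re b" "Im a \<le> Im b"
  shows "emeasure lborel (cbox a b) = ennreal ((Re b - Re a) * (Im b - Im a))"
  using assms by (subst emeasure_lborel_cbox) (auto simp: Basis_complex_def)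

lemma space_unit_square: "space unit_square = cbox 0 (Complex 1 1)"
  by (simp add: unit_square_def space_restrict_space)

lemma emeasure_unit_square_le:
  assumes "X \<in> sets borel"
  shows "emeasure unit_square (X \<inter> space unit_square) \<le> emeasure lborel X"
proof -
  have "emeasure unit_square (X \<inter> space unit_square) = emeasure lborel (X \<inter> space unit_square)"
    unfolding space_unit_square unfolding unit_square_def
    by (rule emeasure_restrict_space) auto
  also have "\<dots> \<le> emeasure lborel X" using assms by (intro emeasure_mono) auto
  finally show ?thesis .
qed

lemma emeasure_space_unit_square: "emeasure unit_square (space unit_square) = 1"
proof -
  have "emeasure unit_square (space unit_square) = emeasure lborel (cbox 0 (Complex 1 1))"
    unfolding space_unit_square unfolding unit_square_def by (rule emeasure_restrict_space) auto
  then show ?thesis by (subst (asm) emeasure_lborel_cbox_complex) auto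
qed

lemma borel_measurable_unit_square: "(\<lambda>z. z) \<in> borel_measurable unit_square"
  unfolding unit_square_def by (intro measurable_restrict_space1) simp

lemma emeasure_unit_square_disc_le:
  assumes "0 \<le> r"
  shows "emeasure unit_square {v \<in> space unit_square. cmod (v - p) \<le> r} \<le> ennreal (4 * r\<^sup>2)"
proof -
  let ?X = "cbox (Complex (Re p - r) (Im p - r)) (Complex (Re p + r) (Im p + r))"
  have "{v \<in> space unit_square. cmod (v - p) \<le> r} \<subseteq> ?X \<inter> space unit_square"
  proof
    fix v assume v: "v \<in> {v \<in> space unit_square. cmod (v - p) \<le> r}"
    then have "\<bar>Re v - Re p\<bar> \<le> r" "\<bar>Im v - Im p\<bar> \<le> r"
      using abs_Re_le_cmod[of "v - p"] abs_Im_le_cmod[of "v - p"] by auto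
    with v show "v \<in> ?X \<inter> space unit_square" by (auto simp: cbox_complex)
  qed
  then have "emeasure unit_square {v \<in> space unit_square. cmod (v - p) \<le> r}
      \<le> emeasure unit_square (?X \<inter> space unit_square)"
    by (rule emeasure_mono) (simp add: unit_square_def sets_restrict_space_iff space_restrict_space)
  also have "\<dots> \<le> emeasure lborel ?X" by (rule emeasure_unit_square_le) simp
  also have "\<dots> = ennreal (4 * r\<^sup>2)"
    using assms by (subst emeasure_lborel_cbox_complex) (auto simp: power2_eq_square)
  finally show ?thesis .
qed

text \<open>Around any of its points \<open>p\<close>, the set \<open>V\<close> fits into a
  horizontal strip of width 1 and height \<open>2 * r\<close>.\<close>

lemma emeasure_unit_square_strip_le:
  assumes "0 \<le> r" and V: "\<And>v w. v \<in> V \<Longrightarrow> w \<in> V \<Longrightarrow> \<bar>Im v - Im w\<bar> \<le> r"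
    and sub: "V \<subseteq> space unit_square"
  shows "emeasure unit_square V \<le> ennreal (2 * r)"
proof (cases "V = {}")
  case False
  then obtain p where p: "p \<in> V" by auto
  let ?X = "cbox (Complex 0 (Im p - r)) (Complex 1 (Im p + r))"
  have "V \<subseteq> ?X \<inter> space unit_square"
  proof
    fix v assume v: "v \<in> V"
    with sub show "v \<in> ?X \<inter> space unit_square"
      using V[OF v p] by (auto simp: cbox_complex space_unit_square abs_le_iff)
  qed
  then have "emeasure unit_square V \<le> emeasure unit_square (?X \<inter> space unit_square)"
    by (rule emeasure_mono) (simp add: unit_square_def sets_restrict_space_iff space_restrict_space)
  also have "\<dots> \<le> emeasure lborel ?X" by (rule emeasure_unit_square_le) simp
  also have "\<dots> = ennreal (2 * r)"
    using assms by (subst emeasure_lborel_cbox_complex) auto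
  finally show ?thesis .
qed simp

text \<open>Points are functions rather than vectors so that \<open>PiM\<close> and its Fubini
  theorem apply.\<close>

definition unit_cube :: "('n::finite \<Rightarrow> complex) measure" where
  "unit_cube = PiM UNIV (\<lambda>_. unit_square)"

lemma product_sigma_finite_unit_square: "product_sigma_finite (\<lambda>_. unit_square)"
  unfolding product_sigma_finite_def unit_square_def
  by (intro allI sigma_finite_measure_restrict_space lborel.sigma_finite_measure_axioms) simp

lemma space_unit_cube: "space unit_cube = {w. \<forall>i. w i \<in> space unit_square}"
  by (auto simp: unit_cube_def space_PiM PiE_def extensional_def)

lemma emeasure_space_unit_cube: "emeasure unit_cube (space unit_cube) = 1"
proof -
  interpret product_sigma_finite "\<lambda>_. unit_square" by (rule product_sigma_finite_unit_square)
  show ?thesis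
    unfolding unit_cube_def space_PiM
    by (subst emeasure_PiM) (simp_all add: emeasure_space_unit_square)
qed

lemma borel_measurable_unit_cube: "(\<lambda>w. w i) \<in> borel_measurable unit_cube"
proof -
  have "(\<lambda>w. w i) \<in> measurable unit_cube unit_square"
    unfolding unit_cube_def by simp
  from measurable_compose[OF this borel_measurable_unit_square] show ?thesis .
qed

text \<open>Fubini with coordinate \<open>j\<close> integrated first: each slice lies in a strip of
  area at most \<open>2 * b\<close>, and a slice is nonempty only if the other coordinates lie in
  their discs. The strip condition compares points of one slice only, so the strip may move with the
  other coordinates.\<close>

lemma emeasure_unit_cube_le:
  fixes S :: "('n::finite \<Rightarrow> complex) set"
  assumes S: "S \<in> sets unit_cube" and r: "0 \<le> r" and b: "0 \<le> b"
    and disc: "\<And>w i. w \<in> S \<Longrightarrow> i \<noteq> j \<Longrightarrow> cmod (w i - p i) \<le> r"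
    and strip: "\<And>w u v. w(j := u) \<in> S \<Longrightarrow> w(j := v) \<in> S \<Longrightarrow> \<bar>Im u - Im v\<bar> \<le> b"
  shows "emeasure unit_cube S \<le> ennreal ((4 * r\<^sup>2) ^ (CARD('n) - 1) * (2 * b))"
proof -
  interpret product_sigma_finite "\<lambda>_. unit_square" by (rule product_sigma_finite_unit_square)
  define I where "I = (UNIV :: 'n set) - {j}"
  have I: "finite I" "j \<notin> I" "insert j I = UNIV" by (auto simp: I_def)
  define D where "D i = {v \<in> space unit_square. cmod (v - p i) \<le> r}" for i
  have Dm: "D i \<in> sets unit_square" for i
  proof -
    note borel_measurable_unit_square [measurable]
    show ?thesis unfolding D_def by measurable
  qed
  have "emeasure unit_cube S = (\<integral>\<^sup>+ w. indicator S w \<partial>unit_cube)" using S by simp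
  also have "\<dots> = (\<integral>\<^sup>+ x. (\<integral>\<^sup>+ y. indicator S (x(j := y)) \<partial>unit_square) \<partial>PiM I (\<lambda>_. unit_square))"
    unfolding unit_cube_def I(3)[symmetric]
    using S by (intro product_nn_integral_insert) (auto simp: I unit_cube_def)
  also have "\<dots> \<le> (\<integral>\<^sup>+ x. ennreal (2 * b) * indicator (Pi\<^sub>E I D) x \<partial>PiM I (\<lambda>_. unit_square))"
  proof (rule nn_integral_mono)
    fix x :: "'n \<Rightarrow> complex" assume x: "x \<in> space (PiM I (\<lambda>_. unit_square))"
    define V where "V = {y \<in> space unit_square. x(j := y) \<in> S}"
    have "(\<lambda>y. x(j := y)) \<in> measurable unit_square (PiM (insert j I) (\<lambda>_. unit_square))"
      using x by (intro measurable_fun_upd[where J=I]) auto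
    then have m: "(\<lambda>y. x(j := y)) \<in> measurable unit_square unit_cube"
      by (simp add: unit_cube_def I)
    have "(\<lambda>y. x(j := y)) -` S \<inter> space unit_square \<in> sets unit_square"
      using m S by (rule measurable_sets)
    also have "(\<lambda>y. x(j := y)) -` S \<inter> space unit_square = V" by (auto simp: V_def)
    finally have Vm: "V \<in> sets unit_square" .
    have "(\<integral>\<^sup>+ y. indicator S (x(j := y)) \<partial>unit_square) = (\<integral>\<^sup>+ y. indicator V y \<partial>unit_square)"
      by (intro nn_integral_cong) (auto simp: V_def indicator_def)
    also have "\<dots> = emeasure unit_square V" using Vm by simp
    also have "\<dots> \<le> ennreal (2 * b) * indicator (Pi\<^sub>E I D) x"
    proof (cases "V = {}")
      case False
      then obtain y where y: "x(j := y) \<in> S" by (auto simp: V_def)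
      have "x i \<in> D i" if "i \<in> I" for i
        using disc[OF y, of i] that x by (auto simp: I_def D_def space_PiM)
      then have "x \<in> Pi\<^sub>E I D" using x by (auto simp: space_PiM)
      moreover have "emeasure unit_square V \<le> ennreal (2 * b)"
        by (rule emeasure_unit_square_strip_le) (auto simp: V_def b strip)
      ultimately show ?thesis by simp
    qed simp
    finally show "(\<integral>\<^sup>+ y. indicator S (x(j := y)) \<partial>unit_square) \<le> ennreal (2 * b) * indicator (Pi\<^sub>E I D) x" .
  qed
  also have "\<dots> = ennreal (2 * b) * emeasure (PiM I (\<lambda>_. unit_square)) (Pi\<^sub>E I D)"
    using I(1) Dm by (intro nn_integral_cmult_indicator sets_PiM_I_finite) auto
  also have "\<dots> = ennreal (2 * b) * (\<Prod>i\<in>I. emeasure unit_square (D i))"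
    using I(1) Dm by (subst emeasure_PiM) auto
  also have "\<dots> \<le> ennreal (2 * b) * (\<Prod>i\<in>I. ennreal (4 * r\<^sup>2))"
  proof (rule mult_left_mono)
    show "(\<Prod>i\<in>I. emeasure unit_square (D i)) \<le> (\<Prod>i\<in>I. ennreal (4 * r\<^sup>2))"
      using I(1)
      by (induction I rule: finite_induct)
        (auto simp: D_def intro!: mult_mono emeasure_unit_square_disc_le r)
  qed simp
  also have "\<dots> = ennreal ((4 * r\<^sup>2) ^ (CARD('n) - 1) * (2 * b))"
  proof -
    have "(\<Prod>i\<in>I. ennreal (4 * r\<^sup>2)) = ennreal ((4 * r\<^sup>2) ^ (CARD('n) - 1))"
      by (subst ennreal_power[symmetric]) (simp_all add: I_def card_Diff_singleton)
    then show ?thesis using b by (simp add: mult.commute flip: ennreal_mult)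
  qed
  finally show ?thesis .
qed

section \<open>Patches of the spheres and the fraction of a patch near a given point\<close>

text \<open>The \<open>j\<close>-th coordinate of the value is chosen such that \<open>(norm z)\<^sup>2 = 1 - d\<close>.
  The real part of \<open>w j\<close> is ignored, since the sphere has odd dimension.\<close>

definition sphere_chart :: "'n::finite \<Rightarrow> real \<Rightarrow> real \<Rightarrow> ('n \<Rightarrow> complex) \<Rightarrow> complex ^ 'n" where
  "sphere_chart j e d w = (\<chi> i. if i = j
     then Complex (sqrt (1 - d - ((\<Sum>i\<in>UNIV - {j}. (e * cmod (w i))\<^sup>2) + (e * Im (w j))\<^sup>2))) (e * Im (w j))
     else of_real e * w i)"

lemma sphere_chart_nth:
  "sphere_chart j e d w $ j =
     Complex (sqrt (1 - d - ((\<Sum>i\<in>UNIV - {j}. (e * cmod (w i))\<^sup>2) + (e * Im (w j))\<^sup>2))) (e * Im (w j))"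
  "i \<noteq> j \<Longrightarrow> sphere_chart j e d w $ i = of_real e * w i"
  by (simp_all add: sphere_chart_def)

lemma borel_measurable_sphere_chart [measurable]:
  "sphere_chart j e d \<in> borel_measurable (unit_cube :: ('n::finite \<Rightarrow> complex) measure)"
proof -
  note borel_measurable_unit_cube [measurable]
  have "(\<lambda>w. sphere_chart j e d w $ i) \<in> borel_measurable (unit_cube :: ('n \<Rightarrow> complex) measure)" for i
  proof (cases "i = j")
    case True
    show ?thesis unfolding True sphere_chart_nth(1) Complex_eq by measurable
  next
    case False
    show ?thesis unfolding sphere_chart_nth(2)[OF False] by measurable
  qed
  then show ?thesis
    by (subst borel_measurable_euclidean_space) (auto simp: Basis_vec_def inner_axis)
qed

lemma borel_measurable_hinner [measurable]: "(\<lambda>z. hinner z a) \<in> borel_measurable borel"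
  unfolding hinner_def by (intro borel_measurable_continuous_onI continuous_intros)

lemma unit_cube_cmod_le:
  assumes "w \<in> space unit_cube"
  shows "cmod (w i) \<le> 2" and "\<bar>Im (w i)\<bar> \<le> 1"
proof -
  have "w i \<in> cbox 0 (Complex 1 1)" using assms by (simp add: space_unit_cube space_unit_square)
  then show "cmod (w i) \<le> 2" "\<bar>Im (w i)\<bar> \<le> 1"
    using cmod_le[of "w i"] by (auto simp: cbox_complex)
qed

context
  fixes e :: real and j :: "'n::finite"
  assumes e: "0 < e" "16 * real CARD('n) * e \<le> 1"
begin

lemma chart_scale_le: "e \<le> 1 / 16"
proof -
  have "e \<le> real CARD('n) * e" using e(1) by (simp add: Suc_le_eq)
  then show ?thesis using e(2) by simp
qed

text \<open>The smallness of \<open>e\<close> is calibrated here: there are at most n summands, each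
  at most \<open>2 * e\<close>.\<close>

lemma sphere_chart_sum_le:
  fixes w :: "'n \<Rightarrow> complex"
  assumes w: "w \<in> space unit_cube"
  shows "(\<Sum>i\<in>UNIV - {j}. e * cmod (w i)) \<le> 1 / 8"
proof -
  have "(\<Sum>i\<in>UNIV - {j}. e * cmod (w i)) \<le> (\<Sum>i\<in>(UNIV :: 'n set). e * cmod (w i))"
    using e(1) by (intro sum_mono2) auto
  also have "\<dots> \<le> (\<Sum>i\<in>(UNIV :: 'n set). e * 2)"
    using unit_cube_cmod_le(1)[OF w] e(1) by (intro sum_mono mult_left_mono) auto
  also have "\<dots> \<le> 1 / 8" using e(2) by simp
  finally show ?thesis .
qed

text \<open>For \<open>d \<le> 1 / 8\<close> this keeps the radicand in \<open>sphere_chart\<close>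
  above 27/32, so that squaring really undoes the square root.\<close>

lemma sphere_chart_square_sum_le:
  fixes w :: "'n \<Rightarrow> complex"
  assumes w: "w \<in> space unit_cube"
  shows "(\<Sum>i\<in>UNIV - {j}. (e * cmod (w i))\<^sup>2) + (e * Im (w j))\<^sup>2 \<le> 1 / 32"
proof -
  have ew: "e * cmod (w i) \<le> 1 / 8" "\<bar>e * Im (w i)\<bar> \<le> 1 / 16" for i
    using mult_mono[OF chart_scale_le unit_cube_cmod_le(1)[OF w, of i]]
      mult_mono[OF chart_scale_le unit_cube_cmod_le(2)[OF w, of i]] e(1)
    by (auto simp: abs_mult)
  have "(\<Sum>i\<in>UNIV - {j}. (e * cmod (w i))\<^sup>2) \<le> (\<Sum>i\<in>UNIV - {j}. 1 / 8 * (e * cmod (w i)))"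
    unfolding power2_eq_square using ew e(1) by (intro sum_mono mult_right_mono) auto
  also have "\<dots> = 1 / 8 * (\<Sum>i\<in>UNIV - {j}. e * cmod (w i))"
    by (rule sum_distrib_left[symmetric])
  also have "\<dots> \<le> 1 / 64" using sphere_chart_sum_le[OF w] by simp
  finally have "(\<Sum>i\<in>UNIV - {j}. (e * cmod (w i))\<^sup>2) \<le> 1 / 64" .
  moreover have "(e * Im (w j))\<^sup>2 \<le> (1 / 16)\<^sup>2"
    using ew(2)[of j] by (metis abs_ge_zero power2_abs power_mono)
  ultimately show ?thesis by (simp add: power2_eq_square)
qed

lemma norm_sphere_chart:
  fixes w :: "'n \<Rightarrow> complex"
  assumes w: "w \<in> space unit_cube" and d: "d \<le> 1 / 8"
  shows "(norm (sphere_chart j e d w))\<^sup>2 = 1 - d"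
proof -
  have "(norm (sphere_chart j e d w))\<^sup>2
      = (cmod (sphere_chart j e d w $ j))\<^sup>2 + (\<Sum>i\<in>UNIV - {j}. (cmod (sphere_chart j e d w $ i))\<^sup>2)"
    unfolding norm_vec_complex_power2 by (subst sum.remove[of _ j]) auto
  also have "(\<Sum>i\<in>UNIV - {j}. (cmod (sphere_chart j e d w $ i))\<^sup>2) = (\<Sum>i\<in>UNIV - {j}. (e * cmod (w i))\<^sup>2)"
    using e(1) by (intro sum.cong) (auto simp: sphere_chart_nth(2) norm_mult)
  finally show ?thesis
    using sphere_chart_square_sum_le[OF w] d by (simp add: sphere_chart_nth(1) cmod_power2)
qed

text \<open>One cube contains all patches, so their masses add up inside it. The inner product with
  \<open>axis j 1\<close> is the \<open>j\<close>-th coordinate, whose real part lies in [27/32, 1]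
  and whose imaginary part is at most 1/16 in modulus.\<close>

lemma sphere_chart_in_carleson_cube:
  fixes w :: "'n \<Rightarrow> complex"
  assumes w: "w \<in> space unit_cube" and d: "0 < d" "d \<le> 1 / 8"
  shows "sphere_chart j e d w \<in> carleson_cube (axis j 1) (1 / 2)"
proof -
  define x where "x = 1 - d - ((\<Sum>i\<in>UNIV - {j}. (e * cmod (w i))\<^sup>2) + (e * Im (w j))\<^sup>2)"
  define z where "z = sphere_chart j e d w"
  have "0 \<le> (\<Sum>i\<in>UNIV - {j}. (e * cmod (w i))\<^sup>2) + (e * Im (w j))\<^sup>2"
    by (intro add_nonneg_nonneg sum_nonneg) auto
  then have x: "27 / 32 \<le> x" "x \<le> 1"
    using sphere_chart_square_sum_le[OF w] d by (auto simp: x_def)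
  have "x = sqrt x * sqrt x" using x by simp
  also have "\<dots> \<le> sqrt x" using x by (intro mult_left_le) auto
  finally have sx: "27 / 32 \<le> sqrt x" "sqrt x \<le> 1" using x by auto
  have zj: "z $ j = Complex (sqrt x) (e * Im (w j))"
    by (simp add: z_def sphere_chart_nth(1) x_def)
  have "\<bar>e * Im (w j)\<bar> \<le> 1 / 16"
    using mult_mono[OF chart_scale_le unit_cube_cmod_le(2)[OF w, of j]] e(1) by (simp add: abs_mult)
  then have "cmod (1 - z $ j) < 1 / 2"
    using cmod_le[of "1 - z $ j"] sx by (simp add: zj)
  moreover have "hinner z (axis j 1) = z $ j"
    by (simp add: hinner_def axis_def if_distrib cong: if_cong)
  moreover have "(norm z)\<^sup>2 < 1" using norm_sphere_chart[OF w] d by (simp add: z_def)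
  ultimately show ?thesis
    by (simp add: carleson_cube_def z_def[symmetric] abs_square_less_1)
qed

text \<open>The fraction has order s^n. Each of the n - 1 coordinates other than \<open>j\<close> is
  confined to a disc of radius sqrt (2 s) / e, of area O(s). With these fixed, the kernel condition
  confines \<open>Im (w j)\<close> to an interval of length O(s), since \<open>a $ j\<close> is
  bounded away from 0.\<close>

lemma emeasure_sphere_chart_le:
  fixes a :: "complex ^ 'n"
  assumes d: "0 \<le> d" "d \<le> 1 / 8" and a: "norm a < 1" and s: "0 \<le> s"
  shows "emeasure unit_cube {w \<in> space unit_cube.
      cmod (1 - hinner (sphere_chart j e d w) a) \<le> s \<and> (norm (sphere_chart j e d w - a))\<^sup>2 \<le> 2 * s}
    \<le> ennreal ((16 * s / e\<^sup>2) ^ CARD('n))" (is "emeasure _ ?S \<le> _")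
proof -
  have e2: "0 < e\<^sup>2" "e\<^sup>2 \<le> 1" using e(1) chart_scale_le by (auto simp: power_le_one)
  have Sm: "?S \<in> sets unit_cube" by measurable
  \<comment> \<open>For large \<open>s\<close> the bound exceeds the total mass 1. Otherwise a point
    \<open>w0\<close> of the set supplies the lower bound on \<open>a $ j\<close>.\<close>
  consider "1 / 2 \<le> s" | "?S = {}" | w0 where "s < 1 / 2" "w0 \<in> ?S" by force
  then show ?thesis
  proof cases
    case 1
    have "1 \<le> 16 * s / e\<^sup>2" using 1 e2 by (simp add: le_divide_eq)
    then have "ennreal 1 \<le> ennreal ((16 * s / e\<^sup>2) ^ CARD('n))"
      by (intro ennreal_leI one_le_power)
    moreover have "emeasure unit_cube ?S \<le> ennreal 1"
      using emeasure_space[of unit_cube ?S] unfolding emeasure_space_unit_cube ennreal_1 .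
    ultimately show ?thesis by (rule order_trans[rotated])
  next
    case 2
    show ?thesis unfolding 2 emeasure_empty by (rule zero_le)
  next
    case 3
    \<comment> \<open>Here |<z,a>| is at least 1/2 for the chart value \<open>z\<close> at
      \<open>w0\<close>, and the coordinates other than \<open>j\<close> contribute at most 1/8 to
      it.\<close>
    have aj: "1 / 4 \<le> cmod (a $ j)"
    proof -
      define z where "z = sphere_chart j e d w0"
      have w0: "w0 \<in> space unit_cube" using 3 by simp
      have ai: "cmod (a $ i) \<le> 1" for i
        by (rule order_trans[OF Finite_Cartesian_Product.norm_nth_le]) (use a in simp)
      have "(norm z)\<^sup>2 \<le> 1" using norm_sphere_chart[OF w0 d(2)] d by (simp add: z_def)
      then have "norm z \<le> 1" using abs_square_le_1[of "norm z"] by simp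
      then have zj: "cmod (z $ j) \<le> 1" by (rule order_trans[OF Finite_Cartesian_Product.norm_nth_le])
      have "1 - cmod (hinner z a) \<le> cmod (1 - hinner z a)"
        using norm_triangle_ineq2[of 1 "hinner z a"] by simp
      then have "1 / 2 \<le> cmod (hinner z a)" using 3 by (simp add: z_def)
      also have "\<dots> \<le> (\<Sum>i\<in>UNIV. cmod (z $ i) * cmod (a $ i))"
        unfolding hinner_def by (rule order_trans[OF norm_sum]) (simp add: norm_mult)
      also have "\<dots> = cmod (z $ j) * cmod (a $ j) + (\<Sum>i\<in>UNIV - {j}. cmod (z $ i) * cmod (a $ i))"
        by (rule sum.remove) auto
      also have "\<dots> \<le> cmod (a $ j) + (\<Sum>i\<in>UNIV - {j}. e * cmod (w0 i))"
      proof (intro add_mono sum_mono)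
        show "cmod (z $ j) * cmod (a $ j) \<le> cmod (a $ j)" using zj by (simp add: mult_left_le_one_le)
        show "cmod (z $ i) * cmod (a $ i) \<le> e * cmod (w0 i)" if "i \<in> UNIV - {j}" for i
          using that ai[of i] e(1) by (auto simp: z_def sphere_chart_nth(2) norm_mult intro: mult_left_le)
      qed
      also have "\<dots> \<le> cmod (a $ j) + 1 / 8" using sphere_chart_sum_le[OF w0] by simp
      finally show ?thesis by simp
    qed
    have "emeasure unit_cube ?S
        \<le> ennreal ((4 * (sqrt (2 * s) / e)\<^sup>2) ^ (CARD('n) - 1) * (2 * (8 * s / e)))"
    proof (rule emeasure_unit_cube_le[OF Sm, where p = "\<lambda>i. a $ i / of_real e" and j = j])
      fix w i assume w: "w \<in> ?S" and i: "i \<noteq> j"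
      have "e * cmod (w i - a $ i / of_real e) = cmod (of_real e * (w i - a $ i / of_real e))"
        using e(1) by (simp add: norm_mult)
      also have "of_real e * (w i - a $ i / of_real e) = (sphere_chart j e d w - a) $ i"
        using e(1) i by (simp add: sphere_chart_nth(2) right_diff_distrib)
      also have "cmod ((sphere_chart j e d w - a) $ i) \<le> norm (sphere_chart j e d w - a)" by (rule Finite_Cartesian_Product.norm_nth_le)
      also have "\<dots> \<le> sqrt (2 * s)" using w by (intro real_le_rsqrt) auto
      finally show "cmod (w i - a $ i / of_real e) \<le> sqrt (2 * s) / e"
        using e(1) by (simp add: le_divide_eq mult.commute)
    next
      fix w u v assume uv: "w(j := u) \<in> ?S" "w(j := v) \<in> ?S"
      \<comment> \<open>\<open>y\<close> and \<open>z\<close> differ in coordinate \<open>j\<close>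
        only, so the difference of their inner products with \<open>a\<close> is a single term. Its
        modulus is at most \<open>2 * s\<close>, and dividing by |a_j| \<ge> 1/4 gives the
        8.\<close>
      define y z where "y = sphere_chart j e d (w(j := u))" and "z = sphere_chart j e d (w(j := v))"
      have "hinner y a - hinner z a = (\<Sum>i\<in>UNIV. (y $ i - z $ i) * cnj (a $ i))"
        by (simp add: hinner_def sum_subtractf algebra_simps)
      also have "\<dots> = (y $ j - z $ j) * cnj (a $ j)"
        by (subst sum.remove[of _ j]) (auto simp: y_def z_def sphere_chart_nth(2) intro!: sum.neutral)
      finally have "cmod (y $ j - z $ j) * cmod (a $ j) = cmod (hinner y a - hinner z a)"
        by (simp add: norm_mult)
      also have "hinner y a - hinner z a = (1 - hinner z a) - (1 - hinner y a)" by simp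
      also have "cmod ((1 - hinner z a) - (1 - hinner y a)) \<le> s + s"
        by (rule order_trans[OF norm_triangle_ineq4 add_mono]) (use uv in \<open>auto simp: y_def z_def\<close>)
      finally have "cmod (y $ j - z $ j) * cmod (a $ j) \<le> 2 * s" by simp
      moreover have "cmod (y $ j - z $ j) * (1 / 4) \<le> cmod (y $ j - z $ j) * cmod (a $ j)"
        using aj by (intro mult_left_mono) auto
      moreover have "Im (y $ j - z $ j) = e * (Im u - Im v)"
        by (simp add: y_def z_def sphere_chart_nth(1) right_diff_distrib)
      then have "e * \<bar>Im u - Im v\<bar> \<le> cmod (y $ j - z $ j)"
        using abs_Im_le_cmod[of "y $ j - z $ j"] e(1) by (simp add: abs_mult)
      ultimately have "e * \<bar>Im u - Im v\<bar> \<le> 8 * s" by linarith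
      then show "\<bar>Im u - Im v\<bar> \<le> 8 * s / e"
        using e(1) by (simp add: le_divide_eq mult.commute)
    qed (use s e in auto)
    \<comment> \<open>As \<open>e\<^sup>2 \<le> e\<close>, the strip factor and each disc factor
      admit the same bound, and the product becomes a pure n-th power.\<close>
    also have "\<dots> \<le> ennreal ((16 * s / e\<^sup>2) ^ (CARD('n) - 1) * (16 * s / e\<^sup>2))"
    proof (intro ennreal_leI mult_mono power_mono)
      have "e\<^sup>2 \<le> e" using e(1) chart_scale_le by (simp add: power2_eq_square)
      then have "16 * s / e \<le> 16 * s / e\<^sup>2"
        by (rule divide_left_mono[OF _ _ mult_pos_pos[OF e(1) e2(1)]]) (use s in simp_all)
      then show "2 * (8 * s / e) \<le> 16 * s / e\<^sup>2" by simp
      show "4 * (sqrt (2 * s) / e)\<^sup>2 \<le> 16 * s / e\<^sup>2"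
        using s e2 by (simp add: power_divide divide_right_mono)
    qed (use s e in auto)
    also have "\<dots> = ennreal ((16 * s / e\<^sup>2) ^ CARD('n))"
      by (simp add: power_eq_if mult.commute)
    finally show ?thesis .
  qed
qed

end

section \<open>Assembly of the measure and the two suprema\<close>

text \<open>The weighted sum of image measures is obtained as one image measure: index and parameter
  are drawn jointly from counting measure times \<open>P\<close>, with density \<open>c\<close>.
  Countable additivity is then automatic, and the formula is Tonelli's theorem.\<close>

lemma ex_measure_suminf_distr:
  fixes f :: "nat \<Rightarrow> 'a \<Rightarrow> 'b" and c :: "nat \<Rightarrow> ennreal"
  assumes P: "sigma_finite_measure P" and f: "\<And>k. f k \<in> measurable P N"
  shows "\<exists>M. sets M = sets N \<and>
    (\<forall>G\<in>sets N. emeasure M G = (\<Sum>k. c k * emeasure P {w \<in> space P. f k w \<in> G}))"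
proof -
  interpret sigma_finite_measure P by fact
  let ?K = "count_space UNIV :: nat measure"
  let ?Q = "density (?K \<Otimes>\<^sub>M P) (\<lambda>x. c (fst x))"
  \<comment> \<open>The index set is countable, so measurability of every \<open>f k\<close> yields
    joint measurability.\<close>
  have F: "(\<lambda>x. f (fst x) (snd x)) \<in> measurable (?K \<Otimes>\<^sub>M P) N"
    by (rule measurable_compose_countable[where f = "\<lambda>k x. f k (snd x)"])
      (auto intro: measurable_compose[OF measurable_snd f])
  have cm: "(\<lambda>x. c (fst x)) \<in> borel_measurable (?K \<Otimes>\<^sub>M P)"
    by (rule measurable_compose[OF measurable_fst]) simp
  have "emeasure (distr ?Q N (\<lambda>x. f (fst x) (snd x))) G
      = (\<Sum>k. c k * emeasure P {w \<in> space P. f k w \<in> G})" if G: "G \<in> sets N" for G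
  proof -
    let ?V = "(\<lambda>x. f (fst x) (snd x)) -` G \<inter> space (?K \<Otimes>\<^sub>M P)"
    have V: "?V \<in> sets (?K \<Otimes>\<^sub>M P)" using F G by (rule measurable_sets)
    have Gk: "{w \<in> space P. f k w \<in> G} \<in> sets P" for k
      using measurable_sets[OF f[of k] G] by (simp add: vimage_def Int_def conj_commute)
    have "emeasure (distr ?Q N (\<lambda>x. f (fst x) (snd x))) G = emeasure ?Q ?V"
      using F G by (subst emeasure_distr) auto
    also have "\<dots> = (\<integral>\<^sup>+ x. c (fst x) * indicator ?V x \<partial>(?K \<Otimes>\<^sub>M P))"
      using cm V by (rule emeasure_density)
    also have "\<dots> = (\<integral>\<^sup>+ k. (\<integral>\<^sup>+ w. c (fst (k, w)) * indicator ?V (k, w) \<partial>P) \<partial>?K)"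
      using cm V by (intro nn_integral_fst[symmetric] borel_measurable_times_ennreal borel_measurable_indicator)
    also have "\<dots> = (\<integral>\<^sup>+ k. c k * emeasure P {w \<in> space P. f k w \<in> G} \<partial>?K)"
    proof (rule nn_integral_cong)
      fix k
      have "(\<integral>\<^sup>+ w. c (fst (k, w)) * indicator ?V (k, w) \<partial>P)
          = (\<integral>\<^sup>+ w. c k * indicator {w \<in> space P. f k w \<in> G} w \<partial>P)"
        by (intro nn_integral_cong) (auto simp: indicator_def space_pair_measure)
      also have "\<dots> = c k * emeasure P {w \<in> space P. f k w \<in> G}"
        using Gk by (rule nn_integral_cmult_indicator)
      finally show "(\<integral>\<^sup>+ w. c (fst (k, w)) * indicator ?V (k, w) \<partial>P)
          = c k * emeasure P {w \<in> space P. f k w \<in> G}" .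
    qed
    also have "\<dots> = (\<Sum>k. c k * emeasure P {w \<in> space P. f k w \<in> G})"
      by (rule nn_integral_count_space_nat)
    finally show ?thesis .
  qed
  then show ?thesis by (intro exI[of _ "distr ?Q N (\<lambda>x. f (fst x) (snd x))"]) simp
qed

lemma sets_restrict_space_Collect:
  assumes "S \<in> sets M" "Measurable.pred M Q" "space M = UNIV"
  shows "{z \<in> S. Q z} \<in> sets (restrict_space M S)"
proof -
  have "{z. Q z} \<in> sets M" using assms by (simp add: pred_def)
  with assms(1) have "S \<inter> {z. Q z} \<in> sets M" by (rule sets.Int)
  then show ?thesis
    using assms by (subst sets_restrict_space_iff) (auto simp: Int_def)
qed

text \<open>Bounds the number of spheres that one Bergman ball meets: comparing any index
  \<open>k\<close> of \<open>K\<close> with the least one gives 2 ^ (k - Inf K) \<le> C < 2 ^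
  m.\<close>

lemma finite_card_dyadic_le:
  fixes C :: real
  assumes K: "\<And>i k. i \<in> K \<Longrightarrow> k \<in> K \<Longrightarrow> (1 / 2) ^ i \<le> C * (1 / 2) ^ k" and m: "C < 2 ^ m"
  shows "finite K" and "card K \<le> m"
proof -
  have "K \<subseteq> {Inf K..<Inf K + m}"
  proof
    fix k assume k: "k \<in> K"
    then have i: "Inf K \<in> K" "Inf K \<le> k" by (auto intro: Inf_nat_def1 cInf_lower)
    define l where "l = k - Inf K"
    have kl: "k = Inf K + l" using i by (simp add: l_def)
    have "(1 / 2) ^ Inf K \<le> C * ((1 / 2) ^ Inf K * (1 / 2) ^ l)"
      using K[OF i(1) k] unfolding kl power_add by simp
    then have "2 ^ l \<le> C" by (simp add: field_simps)
    then have "(2::real) ^ l < 2 ^ m" using m by linarith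
    then show "k \<in> {Inf K..<Inf K + m}" using i by (simp add: kl)
  qed
  then show "finite K" "card K \<le> m"
    using finite_subset[of K] card_mono[of "{Inf K..<Inf K + m}" K] by auto
qed

lemma sigma_finite_unit_cube: "sigma_finite_measure (unit_cube :: ('n::finite \<Rightarrow> complex) measure)"
proof (rule finite_measure.axioms(1), rule finite_measureI)
  show "emeasure (unit_cube :: ('n \<Rightarrow> complex) measure) (space unit_cube) \<noteq> \<infinity>"
    by (simp add: emeasure_space_unit_cube)
qed

text \<open>Here \<open>p\<close> stands for n \<gamma>. A sphere with \<open>d k\<close> comparable
  to t = 1 - |a|^2 has weight of order t^(p - n), and the ball takes up a fraction O(t^n) of its
  patch; this leaves O(t^p) for each of boundedly many spheres.\<close>

lemma ex_bergman_not_carleson_measure: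
  fixes p R :: real
  assumes p: "p \<le> real CARD('n::finite)" and R: "R > 0"
  obtains \<mu> :: "(complex ^ 'n) measure" and C :: real and \<zeta> :: "complex ^ 'n"
  where "borel_measure_on (ball 0 1) \<mu>"
    and "\<And>a. a \<in> ball 0 1 \<Longrightarrow> emeasure \<mu> (bergman_ball a R) \<le> ennreal (C * (1 - (norm a)\<^sup>2) powr p)"
    and "norm \<zeta> = 1" and "emeasure \<mu> (carleson_cube \<zeta> (1 / 2)) = \<infinity>"
proof -
  \<comment> \<open>Any coordinate serves; the index type is nonempty.\<close>
  define j :: 'n where "j = undefined"
  define e where "e = 1 / (16 * real CARD('n))"
  have e: "0 < e" "16 * real CARD('n) * e \<le> 1" by (auto simp: e_def)
  define d :: "nat \<Rightarrow> real" where "d k = (1 / 2) ^ k / 8" for k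
  have d: "0 < d k" "d k \<le> 1 / 8" for k
    by (simp_all add: d_def power_le_one)
  define q where "q = p - real CARD('n)"
  have q: "q \<le> 0" using p by (simp add: q_def)
  define B where "B = 2 * exp (2 * R)"
  have B: "0 < B" by (simp add: B_def)
  let ?P = "unit_cube :: ('n \<Rightarrow> complex) measure"
  let ?N = "restrict_space borel (ball 0 1) :: (complex ^ 'n) measure"
  have ball: "sphere_chart j e (d k) w \<in> ball 0 1" if "w \<in> space ?P" for k w
    using sphere_chart_in_carleson_cube[OF e that d] by (simp add: carleson_cube_def)
  have f: "sphere_chart j e (d k) \<in> measurable ?P ?N" for k
    using ball by (intro measurable_restrict_space2 Pi_I borel_measurable_sphere_chart)
  obtain \<mu> where \<mu>: "sets \<mu> = sets ?N \<and> (\<forall>G\<in>sets ?N. emeasure \<mu> G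
      = (\<Sum>k. ennreal (d k powr q) * emeasure ?P {w \<in> space ?P. sphere_chart j e (d k) w \<in> G}))"
    using ex_measure_suminf_distr[OF sigma_finite_unit_cube f, where c = "\<lambda>k. ennreal (d k powr q)"] ..
  note sets = conjunct1[OF \<mu>] and em = bspec[OF conjunct2[OF \<mu>]]
  \<comment> \<open>Two spheres met by the same ball have both their parameters within a factor
    \<open>2 * B\<close> of t, so their ratio is at most \<open>4 * B\<^sup>2\<close>.\<close>
  have "\<exists>m. 4 * B\<^sup>2 < 2 ^ m" by (rule real_arch_pow) simp
  then obtain m where m: "4 * B\<^sup>2 < 2 ^ m" ..
  \<comment> \<open>Number of spheres, times the bound on the weight, times the bound on the
    fraction, with the powers of t split off; nothing in it depends on the centre
    \<open>a\<close>.\<close>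
  define C where "C = real m * ((1 / (2 * B)) powr q * (16 * B / e\<^sup>2) ^ CARD('n))"
  show thesis
  proof (rule that[of \<mu> C "axis j 1"])
    show "borel_measure_on (ball 0 1) \<mu>" using sets by (simp add: borel_measure_on_def)
    show "norm (axis j 1 :: complex ^ 'n) = 1" 
      by (simp add: norm_eq_sqrt_inner inner_axis_axis)
  next
    let ?G = "carleson_cube (axis j 1) (1 / 2) :: (complex ^ 'n) set"
    have G: "?G \<in> sets ?N"
      unfolding carleson_cube_def
    proof (rule sets_restrict_space_Collect)
      show "Measurable.pred borel (\<lambda>z. cmod (1 - hinner z (axis j 1 :: complex ^ 'n)) < 1 / 2)"
        by measurable
    qed auto
    have "{w \<in> space ?P. sphere_chart j e (d k) w \<in> ?G} = space ?P" for k
      using sphere_chart_in_carleson_cube[OF e _ d] by auto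
    then have "emeasure \<mu> ?G = (\<Sum>k. ennreal (d k powr q))"
      by (simp add: em[OF G] emeasure_space_unit_cube)
    also have "\<dots> \<ge> (\<Sum>k::nat. 1)"
    proof (intro suminf_le)
      fix k
      have "d k powr 0 \<le> d k powr q" using d[of k] q by (intro powr_mono') auto
      then have "1 \<le> d k powr q" using d(1)[of k] by simp
      then show "1 \<le> ennreal (d k powr q)" by simp
    qed auto
    also have "(\<Sum>k::nat. 1 :: ennreal) = (\<integral>\<^sup>+(k::nat). 1 \<partial>count_space UNIV)"
      by (rule nn_integral_count_space_nat[symmetric])
    also have "\<dots> = \<infinity>" by simp
    finally show "emeasure \<mu> ?G = \<infinity>" by (simp add: top_unique)
  next
    fix a :: "complex ^ 'n" assume a: "a \<in> ball 0 1"
    define t where "t = 1 - (norm a)\<^sup>2"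
    have t: "0 < t" using a by (simp add: t_def abs_square_less_1)
    \<comment> \<open>A measurable superset of the Bergman ball on which the formula for \<mu> can
      be evaluated.\<close>
    define G where "G = {z \<in> ball 0 1. t \<le> 2 * B * (1 - (norm z)\<^sup>2) \<and> 1 - (norm z)\<^sup>2 \<le> 2 * B * t
      \<and> cmod (1 - hinner z a) \<le> B * t \<and> (norm (z - a))\<^sup>2 \<le> 2 * (B * t)}"
    have G: "G \<in> sets ?N"
      unfolding G_def
    proof (rule sets_restrict_space_Collect)
      show "Measurable.pred borel (\<lambda>z. t \<le> 2 * B * (1 - (norm z)\<^sup>2) \<and> 1 - (norm z)\<^sup>2 \<le> 2 * B * t
          \<and> cmod (1 - hinner z a) \<le> B * t \<and> (norm (z - a))\<^sup>2 \<le> 2 * (B * t))"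
        by measurable
    qed auto
    have sub: "bergman_ball a R \<subseteq> G"
      using bergman_ball_bounds[OF a _ R] by (auto simp: G_def B_def t_def bergman_ball_def mult.assoc)
    \<comment> \<open>Contains every index whose sphere meets \<open>G\<close>, because 1 - |z|^2
      equals \<open>d k\<close> on the \<open>k\<close>-th sphere.\<close>
    define K where "K = {k. t \<le> 2 * B * d k \<and> d k \<le> 2 * B * t}"
    have K: "finite K" "card K \<le> m"
    proof -
      have "(1 / 2) ^ i \<le> 4 * B\<^sup>2 * (1 / 2) ^ k" if "i \<in> K" "k \<in> K" for i k
      proof -
        have "d i \<le> 2 * B * t" using that by (simp add: K_def)
        also have "\<dots> \<le> 2 * B * (2 * B * d k)" using that B by (intro mult_left_mono) (auto simp: K_def)
        finally show ?thesis by (simp add: d_def power2_eq_square)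
      qed
      then show "finite K" "card K \<le> m" using finite_card_dyadic_le[of K] m by blast+
    qed
    define W where "W = (t / (2 * B)) powr q * (16 * (B * t) / e\<^sup>2) ^ CARD('n)"
    define g where "g k = ennreal (d k powr q) * emeasure ?P {w \<in> space ?P. sphere_chart j e (d k) w \<in> G}" for k
    have g0: "g k = 0" if "k \<notin> K" for k
    proof -
      have "{w \<in> space ?P. sphere_chart j e (d k) w \<in> G} = {}"
        using that norm_sphere_chart[OF e _ d(2)] by (auto simp: G_def K_def)
      then show ?thesis by (simp only: g_def emeasure_empty mult_zero_right)
    qed
    have gW: "g k \<le> ennreal W" if k: "k \<in> K" for k
    proof -
      let ?S = "{w \<in> space ?P. cmod (1 - hinner (sphere_chart j e (d k) w) a) \<le> B * t
        \<and> (norm (sphere_chart j e (d k) w - a))\<^sup>2 \<le> 2 * (B * t)}"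
      have "emeasure ?P {w \<in> space ?P. sphere_chart j e (d k) w \<in> G} \<le> emeasure ?P ?S"
      proof (rule emeasure_mono)
        show "{w \<in> space ?P. sphere_chart j e (d k) w \<in> G} \<subseteq> ?S" by (auto simp: G_def)
        show "?S \<in> sets ?P" by measurable
      qed
      also have "\<dots> \<le> ennreal ((16 * (B * t) / e\<^sup>2) ^ CARD('n))"
        using a B t d[of k] by (intro emeasure_sphere_chart_le e) auto
      finally have "g k \<le> ennreal (d k powr q) * ennreal ((16 * (B * t) / e\<^sup>2) ^ CARD('n))"
        unfolding g_def by (intro mult_left_mono) auto
      \<comment> \<open>As \<open>q \<le> 0\<close>, the power is decreasing, and the lower bound on
        \<open>d k\<close> turns into an upper bound on the weight.\<close>
      also have "\<dots> \<le> ennreal ((t / (2 * B)) powr q) * ennreal ((16 * (B * t) / e\<^sup>2) ^ CARD('n))"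
      proof (intro mult_right_mono ennreal_leI powr_mono2')
        show "t / (2 * B) \<le> d k" using k B by (simp add: K_def divide_le_eq mult.commute)
      qed (use q t B in auto)
      also have "\<dots> = ennreal W" using B t by (simp add: W_def ennreal_mult)
      finally show ?thesis .
    qed
    have "emeasure \<mu> (bergman_ball a R) \<le> emeasure \<mu> G"
      using sub G sets by (intro emeasure_mono) auto
    also have "\<dots> = (\<Sum>k. g k)" by (simp add: em[OF G] g_def)
    also have "\<dots> = (\<Sum>k\<in>K. g k)" using K(1) g0 by (intro suminf_finite) auto
    also have "\<dots> \<le> of_nat (card K) * ennreal W" using gW by (rule sum_bounded_above)
    also have "\<dots> \<le> of_nat m * ennreal W" using K(2) by (intro mult_right_mono) auto
    also have "\<dots> = ennreal (real m * W)" by (simp add: ennreal_mult' ennreal_of_nat_eq_real_of_nat)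
    \<comment> \<open>The weight exponent \<open>q = p - n\<close> is chosen so that t^q and t^n
      combine to t^p.\<close>
    also have "real m * W = C * t powr p"
    proof -
      have "(t / (2 * B)) powr q = (1 / (2 * B)) powr q * t powr q"
        using t B by (subst powr_mult[symmetric]) auto
      moreover have "(16 * (B * t) / e\<^sup>2) ^ CARD('n) = (16 * B / e\<^sup>2) ^ CARD('n) * t powr real CARD('n)"
        using t by (simp add: powr_realpow power_mult_distrib power_divide)
      moreover have "t powr p = t powr q * t powr real CARD('n)"
        by (simp add: q_def flip: powr_add)
      ultimately show ?thesis by (simp add: W_def C_def)
    qed
    finally show "emeasure \<mu> (bergman_ball a R) \<le> ennreal (C * (1 - (norm a)\<^sup>2) powr p)"
      by (simp add: t_def)
  qed
qed

theorem mainTheorem2: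
  fixes \<gamma> R :: real
  assumes "(real CARD('n::finite) - 1) / real CARD('n) < \<gamma>" and "\<gamma> \<le> 1" and "R > 0"
  shows "\<not> (\<forall>\<mu> :: (complex ^ 'n) measure. borel_measure_on (ball 0 1) \<mu> \<longrightarrow>
    ((SUP a\<in>ball 0 1. emeasure \<mu> (bergman_ball a R)
          / ennreal ((1 - (norm a)\<^sup>2) powr (real CARD('n) * \<gamma>))) < \<infinity>
     \<longleftrightarrow>
     (SUP (\<zeta>, r)\<in>sphere 0 1 \<times> {0<..<1}. emeasure \<mu> (carleson_cube \<zeta> r)
          / ennreal (r powr (real CARD('n) * \<gamma>))) < \<infinity>))"
proof -
  define p where "p = real CARD('n) * \<gamma>"
  have "p \<le> real CARD('n)" using assms(2) by (simp add: p_def mult_left_le)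
  from ex_bergman_not_carleson_measure[OF this assms(3)]
  obtain \<mu> :: "(complex ^ 'n) measure" and C \<zeta> where \<mu>: "borel_measure_on (ball 0 1) \<mu>"
    and C: "\<And>a. a \<in> ball 0 1 \<Longrightarrow> emeasure \<mu> (bergman_ball a R) \<le> ennreal (C * (1 - (norm a)\<^sup>2) powr p)"
    and \<zeta>: "norm \<zeta> = 1" "emeasure \<mu> (carleson_cube \<zeta> (1 / 2)) = \<infinity>"
    by metis
  have "(SUP a\<in>ball 0 1. emeasure \<mu> (bergman_ball a R) / ennreal ((1 - (norm a)\<^sup>2) powr p)) \<le> ennreal C"
  proof (rule SUP_least, rule divide_le_posI_ennreal)
    fix a :: "complex ^ 'n" assume a: "a \<in> ball 0 1"
    then have "0 < 1 - (norm a)\<^sup>2" by (simp add: abs_square_less_1)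
    then show "0 < ennreal ((1 - (norm a)\<^sup>2) powr p)" by simp
    show "emeasure \<mu> (bergman_ball a R) \<le> ennreal ((1 - (norm a)\<^sup>2) powr p) * ennreal C"
      using C[OF a] by (simp add: ennreal_mult'' mult.commute)
  qed
  also have "\<dots> < \<infinity>" by simp
  finally have bergman: "(SUP a\<in>ball 0 1. emeasure \<mu> (bergman_ball a R)
      / ennreal ((1 - (norm a)\<^sup>2) powr p)) < \<infinity>" .
  \<comment> \<open>A single cube of radius 1/2 decides the second supremum: infinite mass over a
    finite divisor remains infinite in \<open>ennreal\<close>.\<close>
  have "\<infinity> = emeasure \<mu> (carleson_cube \<zeta> (1 / 2)) / ennreal ((1 / 2) powr p)"
    by (simp add: \<zeta> ennreal_top_divide)
  also have "\<dots> \<le> (SUP (\<zeta>, r)\<in>sphere 0 1 \<times> {0<..<1}. emeasure \<mu> (carleson_cube \<zeta> r) / ennreal (r powr p))"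
    by (rule SUP_upper2[of "(\<zeta>, 1 / 2)"]) (auto simp: \<zeta>(1))
  finally have "\<not> (SUP (\<zeta>, r)\<in>sphere 0 1 \<times> {0<..<1}. emeasure \<mu> (carleson_cube \<zeta> r)
      / ennreal (r powr p)) < \<infinity>"
    by (rule leD)
  with \<mu> bergman show ?thesis unfolding p_def by blast
qed

end
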